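(* Let $f:\mathbb{Z}^+\to\mathbb{Z}_{\ge 0}$ be a function that is not identically zero. For every legal construction $\mathbf{G}=(G_1, G_2, \dots)$ for Builder (with respect to $f$) and for every sequence $\mathbf{v}=(v_1,v_2,\dots)$ of fire sources for $\mathbf{G}$, every legal construction $\mathbf{T}=(T_1, T_2, \dots)$ (with respect to $f$) such that $T_n$ is a spanning tree of $G_n$ for all $n\in \mathbb{Z}^+$ satisfies $$\underline{\delta}(\mathbf{T}, \mathbf{v}) \leq \underline{\delta}(\mathbf{G}, \mathbf{v})\quad\text{and}\quad \overline{\delta}(\mathbf{T}, \mathbf{v}) \leq \overline{\delta}(\mathbf{G}, \mathbf{v}).$$
   Context: All graphs are finite and simple. Given $f:\mathbb{Z}^+\to\mathbb{Z}_{\ge0}$, a legal construction for Builder is a sequence of graphs $(G_1,G_2,\dots)$ such that for each $n\in\mathbb{Z}^+$, $G_n$ is a connected graph with $\sum_{k=1}^n f(k)$ vertices (the graph with no vertices being allowed, and regarded as its own spanning tree, when this sum is $0$), $G_n\subseteq G_{n+1}$, and the subgraph of $G_{n+1}$ induced by $V(G_n)$ is $G_n$. Burning process. Let $\mathbf{G}=(G_n)_{n\ge1}$ be a legal construction. Given a sequence $\mathbf{v}=(v_n)_{n\ge 1}$, where each $v_n$ is either a vertex of $G_n$ or "no source", put $B_0=\emptyset$ and, for $n\ge1$, let $B_n$ consist of the vertices of $B_{n-1}$, all vertices of $G_n$ adjacent in $G_n$ to a vertex of $B_{n-1}$ (the fire spreads), and the vertex $v_n$ (if it is a vertex). $B_n$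 is the set of burning vertices at the end of round $n$. The sequence $\mathbf{v}$ is a sequence of fire sources for $\mathbf{G}$ if for each $n$ the vertex $v_n\in V(G_n)$ is unburned just before it is selected (i.e. it is neither in $B_{n-1}$ nor adjacent in $G_n$ to a vertex of $B_{n-1}$), except that $v_n$ is "no source" when no such vertex exists. In the process on $\mathbf{T}$, where $V(T_n)=V(G_n)$, the same sequence $\mathbf{v}$ is used, with the spread taking place along the edges of $T_n$. With $V_n=V(G_n)$, define $$\underline{\delta}(\mathbf{G},\mathbf{v})=\liminf_{n\to\infty}\frac{|B_n|}{|V_n|},\qquad \overline{\delta}(\mathbf{G},\mathbf{v})=\limsup_{n\to\infty}\frac{|B_n|}{|V_n|}$$ (only the $n$ with $V_n\ne\emptyset$ are considered), and similarly $\underline{\delta}(\mathbf{T},\mathbf{v})$, $\overline{\delta}(\mathbf{T},\mathbf{v})$ using the sets of burning vertices of the process on $\mathbf{T}$. *)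

theory Defs
  imports "HOL-Library.Extended_Real" "Graph_Theory.Digraph_Component"
begin

text \<open>
  Finite simple graphs are the symmetric loop-free finite digraphs \<^locale>\<open>pair_graph\<close>:
  an edge is represented by its two opposite arcs. Sequences of graphs and of fire sources are
  functions on \<^typ>\<open>nat\<close> whose value at index 0 is irrelevant.
\<close>

text \<open>
  In a symmetric digraph every edge gives a directed cycle of length 2, so the library's
  \<^const>\<open>forest\<close> and \<^const>\<open>tree\<close> do not describe undirected trees. The cycles of the underlying
  simple graph are the directed cycles of length at least 3.
\<close>

definition simple_tree :: "'a pair_pre_digraph \<Rightarrow> bool" where
  "simple_tree T \<longleftrightarrow> pair_graph T \<and> Digraph_Component.connected (with_proj T) \<and>
     \<not> (\<exists>p. pre_digraph.cycle (with_proj T) p \<and> 3 \<le> length p)"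

text \<open>
  The graph with no vertices counts as connected and as its own spanning tree, whereas the
  library's connectedness excludes it; hence the explicit empty case below.
\<close>

definition simple_spanning_tree :: "'a pair_pre_digraph \<Rightarrow> 'a pair_pre_digraph \<Rightarrow> bool" where
  "simple_spanning_tree T H \<longleftrightarrow>
     spanning (with_proj T) (with_proj H) \<and> (pverts T = {} \<or> simple_tree T)"

definition legal_construction :: "(nat \<Rightarrow> nat) \<Rightarrow> (nat \<Rightarrow> 'a pair_pre_digraph) \<Rightarrow> bool" where
  "legal_construction f G \<longleftrightarrow> (\<forall>n\<ge>1.
     pair_graph (G n) \<and>
     (pverts (G n) = {} \<or> Digraph_Component.connected (with_proj (G n))) \<and>
     card (pverts (G n)) = (\<Sum>k=1..n. f k) \<and>
     induced_subgraph (with_proj (G n)) (with_proj (G (Suc n))))"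

definition spread :: "'a pair_pre_digraph \<Rightarrow> 'a set \<Rightarrow> 'a set" where
  "spread H B = B \<union> {w \<in> pverts H. \<exists>u\<in>B. (u, w) \<in> parcs H}"

text \<open>\<open>v n = None\<close> means that no source is chosen in round \<open>n\<close>.\<close>

primrec burning :: "(nat \<Rightarrow> 'a pair_pre_digraph) \<Rightarrow> (nat \<Rightarrow> 'a option) \<Rightarrow> nat \<Rightarrow> 'a set" where
  "burning G v 0 = {}"
| "burning G v (Suc n) = spread (G (Suc n)) (burning G v n) \<union> set_option (v (Suc n))"

definition unburned :: "(nat \<Rightarrow> 'a pair_pre_digraph) \<Rightarrow> (nat \<Rightarrow> 'a option) \<Rightarrow> nat \<Rightarrow> 'a set" where
  "unburned G v n = pverts (G n) - spread (G n) (burning G v (n - 1))"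

definition fire_sources :: "(nat \<Rightarrow> 'a pair_pre_digraph) \<Rightarrow> (nat \<Rightarrow> 'a option) \<Rightarrow> bool" where
  "fire_sources G v \<longleftrightarrow> (\<forall>n\<ge>1.
     case v n of Some x \<Rightarrow> x \<in> unburned G v n | None \<Rightarrow> unburned G v n = {})"

definition burned_ratio :: "(nat \<Rightarrow> 'a pair_pre_digraph) \<Rightarrow> (nat \<Rightarrow> 'a option) \<Rightarrow> nat \<Rightarrow> ereal" where
  "burned_ratio G v n = ereal (real (card (burning G v n)) / real (card (pverts (G n))))"

text \<open>The filter: \<open>n\<close> tends to infinity through those \<open>n\<close> for which \<open>G n\<close> has a vertex.\<close>

definition nonempty_rounds :: "(nat \<Rightarrow> 'a pair_pre_digraph) \<Rightarrow> nat filter" where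
  "nonempty_rounds G = inf sequentially (principal {n. pverts (G n) \<noteq> {}})"

definition lower_burning_density :: "(nat \<Rightarrow> 'a pair_pre_digraph) \<Rightarrow> (nat \<Rightarrow> 'a option) \<Rightarrow> ereal" where
  "lower_burning_density G v = Liminf (nonempty_rounds G) (burned_ratio G v)"

definition upper_burning_density :: "(nat \<Rightarrow> 'a pair_pre_digraph) \<Rightarrow> (nat \<Rightarrow> 'a option) \<Rightarrow> ereal" where
  "upper_burning_density G v = Limsup (nonempty_rounds G) (burned_ratio G v)"

end

theory Submission
  imports Defs
begin

text \<open>
  Every edge of a spanning tree is an edge of the graph that it spans, so under the same sources
  the fire on the tree never gets ahead of the fire on the graph: round by round, the burning set
  of \<open>T\<close> is contained in that of \<open>G\<close> (\<open>burning_mono\<close>). Both graphs have the same vertices in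
  every round, so the burned ratios, which have equal denominators, compare in the same direction,
  and inferior and superior limits along the same filter preserve the inequality.
\<close>

lemma spread_mono:
  assumes "pverts T \<subseteq> pverts H" "parcs T \<subseteq> parcs H" "A \<subseteq> B"
  shows "spread T A \<subseteq> spread H B"
  using assms unfolding spread_def by blast

lemma burning_mono:
  assumes "\<And>n. n \<ge> 1 \<Longrightarrow> pverts (T n) \<subseteq> pverts (G n)"
    and "\<And>n. n \<ge> 1 \<Longrightarrow> parcs (T n) \<subseteq> parcs (G n)"
  shows "burning T v n \<subseteq> burning G v n"
proof (induction n)
  case (Suc n)
  have "spread (T (Suc n)) (burning T v n) \<subseteq> spread (G (Suc n)) (burning G v n)"
    using assms Suc.IH by (intro spread_mono) auto
  then show ?case by auto
qed simp

text \<open>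
  Finiteness is what lets the inclusion of burning sets pass to their cardinalities, since
  \<^const>\<open>card\<close> is 0 on infinite sets.
\<close>

lemma finite_burning:
  assumes "\<And>n. n \<ge> 1 \<Longrightarrow> finite (pverts (G n))"
  shows "finite (burning G v n)"
proof (induction n)
  case (Suc n)
  have "spread (G (Suc n)) (burning G v n) \<subseteq> burning G v n \<union> pverts (G (Suc n))"
    unfolding spread_def by blast
  then have "finite (spread (G (Suc n)) (burning G v n))"
    using Suc.IH assms[of "Suc n"] by (auto intro: finite_subset)
  then show ?case by simp
qed simp

lemma spanning_with_projD:
  assumes "spanning (with_proj T) (with_proj H)"
  shows "pverts T = pverts H" "parcs T \<subseteq> parcs H"
  using assms unfolding spanning_def subgraph_def by auto

lemma nonempty_rounds_cong:
  assumes "\<And>n. n \<ge> 1 \<Longrightarrow> pverts (T n) = pverts (G n)"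
  shows "nonempty_rounds T = nonempty_rounds G"
proof -
  \<comment> \<open>The vertex sets may differ at index 0, which the filter does not see.\<close>
  have "\<forall>\<^sub>F n in sequentially. pverts (T n) = pverts (G n)"
    using assms unfolding eventually_sequentially by blast
  then show ?thesis
    unfolding nonempty_rounds_def filter_eq_iff eventually_inf_principal
    by (auto elim: eventually_elim2)
qed

theorem theorem3:
  fixes f :: "nat \<Rightarrow> nat"
    and G T :: "nat \<Rightarrow> 'a pair_pre_digraph"
    and v :: "nat \<Rightarrow> 'a option"
  assumes "\<exists>n\<ge>1. f n \<noteq> 0"
    and "legal_construction f G"
    and "fire_sources G v"
    and "legal_construction f T"
    and "\<forall>n\<ge>1. simple_spanning_tree (T n) (G n)"
  shows "lower_burning_density T v \<le> lower_burning_density G v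
       \<and> upper_burning_density T v \<le> upper_burning_density G v"
proof -
  have verts: "pverts (T n) = pverts (G n)" and arcs: "parcs (T n) \<subseteq> parcs (G n)"
    if "n \<ge> 1" for n
    using assms(5) that spanning_with_projD unfolding simple_spanning_tree_def by blast+
  have fin: "finite (pverts (G n))" if "n \<ge> 1" for n
  proof -
    interpret pair_graph "G n"
      using assms(2) that unfolding legal_construction_def by blast
    show ?thesis by simp
  qed
  have le: "burned_ratio T v n \<le> burned_ratio G v n" if "n \<ge> 1" for n
  proof -
    have "card (burning T v n) \<le> card (burning G v n)"
      using verts arcs fin by (intro card_mono finite_burning burning_mono) auto
    then show ?thesis
      unfolding burned_ratio_def verts[OF that] by (simp add: divide_right_mono)
  qed
  have "\<forall>\<^sub>F n in sequentially. burned_ratio T v n \<le> burned_ratio G v n"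
    using le unfolding eventually_sequentially by blast
  then have "\<forall>\<^sub>F n in nonempty_rounds G. burned_ratio T v n \<le> burned_ratio G v n"
    unfolding nonempty_rounds_def eventually_inf_principal by (rule eventually_mono) simp
  moreover have "nonempty_rounds T = nonempty_rounds G"
    using verts by (rule nonempty_rounds_cong)
  ultimately show ?thesis
    unfolding lower_burning_density_def upper_burning_density_def
    by (simp add: Liminf_mono Limsup_mono)
qed

end
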